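(* Let $p\ge 5$ be a prime and let $n\ge 1$ be an integer. Then $$a_0(pn)\equiv a_0(n)\pmod{p^3},$$ where $a_0(n)$ denotes the $n$-th Almkvist–Zudilin number.
   Context: For an integer $n\ge 1$, the Almkvist–Zudilin number $a_0(n)$ is $$a_0(n)=\sum_{k=0}^{\lfloor n/3\rfloor}(-1)^{n-k}\binom{3k}{k}\binom{2k}{k}\binom{n}{3k}\binom{n+k}{k}3^{n-3k}.$$ *)

theory Defs
  imports "HOL-Number_Theory.Number_Theory"
begin

text \<open>Almkvist--Zudilin numbers. All natural-number subtractions below are exact,
  since \<open>k \<le> n div 3\<close>.\<close>
definition almkvist_zudilin :: "nat \<Rightarrow> int" where
  "almkvist_zudilin n =
     (\<Sum>k = 0..n div 3. (-1) ^ (n - k)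
        * int ((3 * k) choose k) * int ((2 * k) choose k)
        * int (n choose (3 * k)) * int ((n + k) choose k) * 3 ^ (n - 3 * k))"

end

theory Submission
  imports Defs
begin

text \<open>
  Write the summand as \<open>(-1)^(n+k) 3^(n-3k) (n+k)! / (k!^4 (n-3k)!)\<close> and group the indices
  \<open>k = pj + r\<close>, \<open>0 \<le> r < p\<close>, of the sum for \<open>pn\<close>.  With \<open>m = n - 3j\<close>, the quotient of the term at
  \<open>pj + r\<close> by the term at \<open>pj\<close> depends modulo \<open>p^3\<close> only on \<open>m\<close> and \<open>r\<close>, so its sum over \<open>r\<close> is
  congruent to a polynomial \<open>B(m) = 1 - U m - V m^2\<close>.  By Ljunggren's congruence the term at \<open>pj\<close> is
  \<open>3^((p-1)m)\<close> times the term at \<open>j\<close> of the sum for \<open>n\<close>, hence it is enough that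
  \<open>3^(pm) B(m) \<equiv> 3^m\<close>.  The same polynomial arises from the terminating balanced series
  \<open>3F2(-N/3, (1-N)/3, (2-N)/3; 1, 1-N; 1)\<close> with \<open>N = pm\<close>, which the Pfaff--Saalschuetz formula sums to
  \<open>3/2 \<cdot> 3^(-N) binom(2N, N)\<close>.  For \<open>m = 1, 2\<close> the series terminates before \<open>r = p\<close> and yields
  the congruence; since \<open>B\<close> is quadratic with \<open>B(0) = 1\<close>, these two cases imply all others.
\<close>

text \<open>Since 2 is invertible modulo an odd \<open>p\<close>, doubling is an injective self-map
  of a finite set. It reindexes the sum in \<open>sum_inverse_squares\<close>.\<close>

lemma bij_betw_double_mod:
  assumes "odd (p::nat)"
  shows "bij_betw (\<lambda>i. 2 * i mod p) {1..<p} {1..<p}"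
proof -
  have cop: "coprime 2 p"
    using assms by simp
  have inj: "inj_on (\<lambda>i. 2 * i mod p) {1..<p}"
  proof (rule inj_onI)
    fix x y assume "x \<in> {1..<p}" "y \<in> {1..<p}" "2 * x mod p = 2 * y mod p"
    then have "[2 * x = 2 * y] (mod p)" "x < p" "y < p"
      by (auto simp: cong_def)
    then show "x = y"
      using cong_mult_lcancel_nat[OF cop] cong_less_modulus_unique_nat by blast
  qed
  have "2 * i mod p \<in> {1..<p}" if "i \<in> {1..<p}" for i
  proof -
    have "\<not> p dvd i"
      using that by (auto dest: dvd_imp_le)
    then have "\<not> p dvd 2 * i"
      using cop coprime_commute coprime_dvd_mult_right_iff by blast
    then have "2 * i mod p \<noteq> 0"
      by (simp add: mod_eq_0_iff_dvd)
    then show ?thesis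
      using that by simp
  qed
  then have "(\<lambda>i. 2 * i mod p) ` {1..<p} = {1..<p}"
    by (intro endo_inj_surj inj) auto
  then show ?thesis
    using inj by (simp add: bij_betw_def)
qed

section \<open>A Pfaff--Saalschuetz sum\<close>

text \<open>
  Summand of the hypergeometric series above, as \<open>(-N)_{3k} = 27^k (-N/3)_k ((1-N)/3)_k ((2-N)/3)_k\<close>.
  For \<open>k \<ge> N \<ge> 1\<close> the numerator vanishes, and so does the term, whatever the denominator is.
\<close>
definition saal :: "nat \<Rightarrow> nat \<Rightarrow> rat" where
  "saal N k = pochhammer (- of_nat N) (3 * k) / (27 ^ k * pochhammer (1 - of_nat N) k * fact k ^ 2)"

lemma pochhammer_neg_eq_0: "N < s \<Longrightarrow> pochhammer (- of_nat N :: rat) s = 0"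
  by (simp add: pochhammer_of_nat_eq_0_iff)

lemma saal_eq_0: "N < 3 * k \<Longrightarrow> saal N k = 0"
  by (simp add: saal_def pochhammer_neg_eq_0)

lemma pochhammer_3_Suc:
  "pochhammer (x :: rat) (3 * Suc k)
     = pochhammer x (3 * k) * (x + of_nat (3 * k)) * (x + of_nat (3 * k) + 1) * (x + of_nat (3 * k) + 2)"
proof -
  have "3 * Suc k = Suc (Suc (Suc (3 * k)))" by simp
  then show ?thesis
    by (simp only: pochhammer_Suc) (simp add: algebra_simps)
qed

text \<open>Ratio of consecutive terms, cleared of denominators so that it survives where
  \<open>saal N k\<close> vanishes. The bound on \<open>k\<close> keeps the factor 1 - N + k of the
  new denominator away from zero.\<close>

lemma saal_Suc_right:
  assumes "Suc k < N"
  shows "saal N (Suc k) * (27 * (of_nat k + 1)^2 * (of_nat N - 1 - of_nat k))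
           = saal N k * (of_nat N - 3 * of_nat k) * (of_nat N - 3 * of_nat k - 1) * (of_nat N - 3 * of_nat k - 2)"
proof -
  have nz: "pochhammer (1 - of_nat N :: rat) k \<noteq> 0"
    using assms by (auto simp: pochhammer_eq_0_iff)
  have nz2: "1 - of_nat N + of_nat k \<noteq> (0::rat)"
  proof
    assume "1 - of_nat N + of_nat k = (0::rat)"
    then have "(of_nat N :: rat) = of_nat (Suc k)" by simp
    then show False using assms by (simp only: of_nat_eq_iff)
  qed
  have nz3: "(of_nat k + 1 :: rat) \<noteq> 0"
    using of_nat_neq_0[of k, where ?'a = rat] by (simp add: add.commute)
  define A where "A = pochhammer (- of_nat N :: rat) (3 * k)"
  define B where "B = pochhammer (1 - of_nat N :: rat) k"
  define f where "f = (fact k :: rat)"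
  have f: "f \<noteq> 0" "B \<noteq> 0" using nz by (simp_all add: f_def B_def)
  have *: "saal N (Suc k) = A * (- of_nat N + 3 * of_nat k) * (- of_nat N + 3 * of_nat k + 1)
      * (- of_nat N + 3 * of_nat k + 2) /
      (27 * 27 ^ k * (B * (1 - of_nat N + of_nat k)) * ((of_nat k + 1) * f)^2)"
    unfolding saal_def pochhammer_3_Suc pochhammer_Suc A_def B_def f_def by (simp add: add.commute)
  have **: "saal N k = A / (27 ^ k * B * f ^ 2)"
    unfolding saal_def A_def B_def f_def by simp
  define q where "q = 1 - of_nat N + (of_nat k :: rat)"
  define P where "P = (- of_nat N + 3 * of_nat k) * (- of_nat N + 3 * of_nat k + 1)
      * (- of_nat N + 3 * of_nat k + 2 :: rat)"
  define l where "l = (of_nat k + 1 :: rat)"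
  have nz4: "q \<noteq> 0" "l \<noteq> 0"
    using nz2 nz3 by (simp_all add: q_def l_def)
  have "saal N (Suc k) * (27 * l^2 * (- q)) = A * P / (27 * 27 ^ k * (B * q) * (l * f)^2) * (27 * l^2 * (- q))"
    unfolding * P_def q_def l_def by (simp add: mult.assoc)
  also have "\<dots> = A / (27 ^ k * B * f ^ 2) * (- P)"
    using nz4 f by (simp add: field_simps power_mult_distrib)
  finally have "saal N (Suc k) * (27 * l^2 * (- q)) = saal N k * (- P)"
    unfolding ** .
  moreover have "- q = of_nat N - 1 - of_nat k"
    by (simp add: q_def)
  moreover have "- P = (of_nat N - 3 * of_nat k) * (of_nat N - 3 * of_nat k - 1) * (of_nat N - 3 * of_nat k - 2)"
    unfolding P_def by (simp add: algebra_simps)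
  ultimately show ?thesis
    unfolding l_def by (simp add: mult.assoc)
qed

text \<open>Shifting \<open>N\<close> moves the base point of each Pochhammer symbol by one;
  splitting off the first or the last factor of a symbol that is one longer links the old and the
  new symbols.\<close>

lemma saal_Suc_left:
  assumes "k < N"
  shows "saal (Suc N) k * (of_nat N * (of_nat N + 1 - 3 * of_nat k))
           = saal N k * ((of_nat N + 1) * (of_nat N - of_nat k))"
proof -
  define x :: rat where "x = - of_nat N"
  have 1: "pochhammer (x - 1) (3 * k) * (x - 1 + of_nat (3 * k)) = (x - 1) * pochhammer x (3 * k)"
    using pochhammer_rec[of "x - 1" "3 * k"] by (simp add: pochhammer_Suc)
  have 2: "pochhammer x k * (x + of_nat k) = x * pochhammer (x + 1) k"
    using pochhammer_rec[of x k] by (simp add: pochhammer_Suc)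
  have nz: "pochhammer x k \<noteq> 0" "pochhammer (x + 1) k \<noteq> 0"
    using assms by (auto simp: pochhammer_eq_0_iff x_def)
  define A B C D where "A = pochhammer (x - 1) (3 * k)" and "B = pochhammer x (3 * k)"
    and "C = pochhammer x k" and "D = pochhammer (x + 1) k"
  have *: "saal (Suc N) k = A / (27 ^ k * C * fact k ^ 2)" "saal N k = B / (27 ^ k * D * fact k ^ 2)"
  proof -
    have "- of_nat (Suc N) = x - 1" "1 - of_nat (Suc N) = x" "- of_nat N = x" "1 - of_nat N = x + 1"
      by (simp_all add: x_def)
    then show "saal (Suc N) k = A / (27 ^ k * C * fact k ^ 2)" "saal N k = B / (27 ^ k * D * fact k ^ 2)"
      by (simp_all only: saal_def A_def B_def C_def D_def)
  qed
  have **: "A * (x - 1 + 3 * of_nat k) = (x - 1) * B" "x * D = C * (x + of_nat k)" "C \<noteq> 0" "D \<noteq> 0"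
    using 1 2 nz by (simp_all add: A_def B_def C_def D_def)
  define u v where "u = of_nat N * (of_nat N + 1 - 3 * of_nat k :: rat)"
    and "v = (of_nat N + 1) * (of_nat N - of_nat k :: rat)"
  have uv: "u = x * (x - 1 + 3 * of_nat k)" "v = (x - 1) * (x + of_nat k)"
    by (simp_all add: u_def v_def x_def algebra_simps)
  have "A * u * D = (A * (x - 1 + 3 * of_nat k)) * (x * D)"
    unfolding uv by simp
  also have "\<dots> = B * v * C"
    unfolding ** uv by simp
  finally have "A / C * u = B / D * v"
    using \<open>C \<noteq> 0\<close> \<open>D \<noteq> 0\<close> by (simp add: field_simps)
  then have "(A / C * u) / (27 ^ k * fact k ^ 2) = (B / D * v) / (27 ^ k * fact k ^ 2)"
    by simp
  then show ?thesis
    unfolding * u_def v_def by (simp add: mult_ac)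
qed

text \<open>The right-hand side is a Zeilberger certificate for the sum over \<open>k\<close>.\<close>
lemma saal_telescope:
  assumes "N \<ge> 1"
  shows "3 * (of_nat N + 1) * (\<Sum>k<K. saal (Suc N) k) - (4 * of_nat N + 2) * (\<Sum>k<K. saal N k)
           = - 27 * of_nat K ^ 2 * saal (Suc N) K / (of_nat N + 1)"
proof (induction K)
  case 0
  then show ?case by simp
next
  case (Suc K)
  have N1: "(of_nat N + 1 :: rat) \<noteq> 0"
    using of_nat_neq_0[of N, where ?'a = rat] by (simp add: add.commute)
  have N0: "(of_nat N :: rat) \<noteq> 0"
    using assms by simp
  have "3 * (of_nat N + 1) * saal (Suc N) K - (4 * of_nat N + 2) * saal N K
      = - 27 * of_nat (Suc K) ^ 2 * saal (Suc N) (Suc K) / (of_nat N + 1)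
        - (- 27 * of_nat K ^ 2 * saal (Suc N) K / (of_nat N + 1))"
  \<comment> \<open>Past the end of the series every term is zero; otherwise
    \<open>N \<ge> 1\<close> forces \<open>K < N\<close>, so both ratio lemmas apply.\<close>
  proof (cases "3 * K > Suc N")
    case True
    then show ?thesis by (simp add: saal_eq_0)
  next
    case False
    then have K: "K < N" using assms by linarith
    have nK: "(of_nat N - of_nat K :: rat) \<noteq> 0"
      using K by simp
    define n k where "n = (of_nat N :: rat)" and "k = (of_nat K :: rat)"
    define a where "a = saal (Suc N) K"
    have 1: "saal (Suc N) (Suc K) * (27 * (k + 1)^2 * (n - k))
       = a * (n + 1 - 3 * k) * (n - 3 * k) * (n - 3 * k - 1)"
      using saal_Suc_right[of K "Suc N"] K by (simp add: n_def k_def a_def algebra_simps)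
    have 2: "a * (n * (n + 1 - 3 * k)) = saal N K * ((n + 1) * (n - k))"
      using saal_Suc_left[OF K] by (simp add: n_def k_def a_def)
    have nz: "n \<noteq> 0" "n + 1 \<noteq> 0" "n - k \<noteq> 0"
      using N1 N0 nK by (simp_all add: n_def k_def)
    define t u where "t = saal N K" and "u = saal (Suc N) (Suc K)"
    \<comment> \<open>After multiplication by \<open>(n - k) * (n + 1)\<close> the two ratios
      express everything through \<open>a\<close>, and a polynomial identity in \<open>n\<close> and
      \<open>k\<close> remains.\<close>
    have "(n - k) * (3 * (n + 1)^2 * a - (4 * n + 2) * t * (n + 1))
        = 3 * (n + 1)^2 * (n - k) * a - (4 * n + 2) * (t * ((n + 1) * (n - k)))"
      by (simp add: algebra_simps)
    also have "\<dots> = 3 * (n + 1)^2 * (n - k) * a - (4 * n + 2) * (a * (n * (n + 1 - 3 * k)))"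
      unfolding 2 t_def ..
    also have "\<dots> = 27 * k^2 * a * (n - k) - a * (n + 1 - 3 * k) * (n - 3 * k) * (n - 3 * k - 1)"
      by (simp add: algebra_simps power2_eq_square)
    also have "\<dots> = (n - k) * (27 * k^2 * a - 27 * (k + 1)^2 * u)"
      unfolding 1[symmetric] u_def by (simp add: algebra_simps)
    finally have "3 * (n + 1)^2 * a - (4 * n + 2) * t * (n + 1) = 27 * k^2 * a - 27 * (k + 1)^2 * u"
      using nz by simp
    then have "(3 * (n + 1) * a - (4 * n + 2) * t) * (n + 1) = 27 * k^2 * a - 27 * (k + 1)^2 * u"
      by (simp add: algebra_simps power2_eq_square)
    then have "3 * (n + 1) * a - (4 * n + 2) * t
      = - 27 * (k + 1) ^ 2 * u / (n + 1) - (- 27 * k ^ 2 * a / (n + 1))"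
      using nz by (simp add: eq_divide_eq diff_divide_distrib[symmetric])
    then show ?thesis
      by (simp add: n_def k_def a_def t_def u_def add.commute)
  qed
  then show ?case
    using Suc.IH by (simp add: algebra_simps)
qed

text \<open>Once the series has ended, the boundary term of the telescoped recurrence is zero, and
  the central binomial coefficients obey the matching first-order recurrence. The induction starts
  at 1: for \<open>N = 0\<close> the two sides would be 2 and 3.\<close>

lemma sum_saal:
  assumes "N \<ge> 1" "N < 3 * K"
  shows "2 * 3 ^ N * (\<Sum>k<K. saal N k) = 3 * of_nat ((2 * N) choose N)"
  using assms
proof (induction N rule: nat_induct_at_least)
  case base
  then have "{..<K} = insert 0 {1..<K}" by auto
  moreover have "(\<Sum>k\<in>{1..<K}. saal 1 k) = 0"
    by (intro sum.neutral ballI saal_eq_0) auto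
  ultimately have "(\<Sum>k<K. saal 1 k) = saal 1 0"
    by simp
  then show ?case by (simp add: saal_def)
next
  case (Suc N)
  define S T where "S = (\<Sum>k<K. saal N k)" and "T = (\<Sum>k<K. saal (Suc N) k)"
  have IH: "2 * 3 ^ N * S = 3 * of_nat ((2 * N) choose N)"
    using Suc by (simp add: S_def)
  have tel: "3 * (of_nat N + 1) * T = (4 * of_nat N + 2) * S"
    using saal_telescope[of N K] saal_eq_0[of "Suc N" K] Suc by (simp add: S_def T_def)
  have "Suc N * ((2 * Suc N) choose Suc N) = (4 * N + 2) * ((2 * N) choose N)"
  proof -
    have 1: "Suc N * ((2 * Suc N) choose Suc N) = (2 * N + 2) * (Suc (2 * N) choose N)"
      using Suc_times_binomial[of N "Suc (2 * N)"] by simp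
    have "Suc (2 * N) choose N = Suc (2 * N) choose Suc N"
      using binomial_symmetric[of N "Suc (2 * N)"] by simp
    moreover have "Suc N * (Suc (2 * N) choose Suc N) = (2 * N + 1) * ((2 * N) choose N)"
      using Suc_times_binomial[of N "2 * N"] by simp
    ultimately have "Suc N * (Suc (2 * N) choose N) = (2 * N + 1) * ((2 * N) choose N)"
      by simp
    then have "(2 * N + 2) * (Suc (2 * N) choose N) = 2 * ((2 * N + 1) * ((2 * N) choose N))"
      by (simp add: algebra_simps)
    with 1 show ?thesis by simp
  qed
  then have bin: "(of_nat N + 1) * of_nat ((2 * Suc N) choose Suc N)
      = (4 * of_nat N + 2) * (of_nat ((2 * N) choose N) :: rat)"
    by (simp only: of_nat_eq_iff[where ?'a = rat, symmetric] of_nat_mult of_nat_add of_nat_Suc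
        of_nat_numeral add.commute)
  have N1: "(of_nat N + 1 :: rat) \<noteq> 0"
    using of_nat_neq_0[of N, where ?'a = rat] by (simp add: add.commute)
  have "(of_nat N + 1) * (2 * 3 ^ Suc N * T) = 2 * 3 ^ N * (3 * (of_nat N + 1) * T)"
    by simp
  also have "\<dots> = (4 * of_nat N + 2) * (2 * 3 ^ N * S)"
    unfolding tel by simp
  also have "\<dots> = 3 * ((4 * of_nat N + 2) * of_nat ((2 * N) choose N))"
    unfolding IH by simp
  also have "\<dots> = (of_nat N + 1) * (3 * of_nat ((2 * Suc N) choose Suc N))"
    unfolding bin[symmetric] by simp
  finally show ?case
    using N1 unfolding T_def by simp
qed

section \<open>Terms of the Almkvist--Zudilin sum\<close>

definition az_term :: "nat \<Rightarrow> nat \<Rightarrow> int" where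
  "az_term N k = (-1) ^ (N - k) * int ((3 * k) choose k) * int ((2 * k) choose k)
        * int (N choose (3 * k)) * int ((N + k) choose k) * 3 ^ (N - 3 * k)"

text \<open>The freedom in \<open>K\<close> later lets the sum for pn be cut into blocks of full
  length \<open>p\<close>.\<close>

lemma almkvist_zudilin_eq_sum:
  assumes "N < 3 * K"
  shows "almkvist_zudilin N = (\<Sum>k<K. az_term N k)"
proof -
  have "(\<Sum>k\<in>{0..N div 3}. az_term N k) = (\<Sum>k<K. az_term N k)"
    using assms by (intro sum.mono_neutral_left) (auto simp: az_term_def binomial_eq_0)
  then show ?thesis
    by (simp add: almkvist_zudilin_def az_term_def)
qed

lemma az_term_eq_0: "N < 3 * k \<Longrightarrow> az_term N k = 0"
  by (simp add: az_term_def)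

text \<open>The factorials (3k)!, (2k)! and N! cancel. The sign exponent \<open>N + k\<close> avoids
  truncated subtraction and keeps its parity when \<open>N\<close> and \<open>k\<close> are both
  multiplied by an odd number.\<close>

lemma az_term_fact:
  assumes "3 * k \<le> N"
  shows "(of_int (az_term N k) :: rat)
           = (-1) ^ (N + k) * 3 ^ (N - 3 * k) * fact (N + k) / (fact k ^ 4 * fact (N - 3 * k))"
proof -
  have sub: "3 * k - k = 2 * k" "2 * k - k = k" "N + k - k = N"
    by simp_all
  have "(-1) ^ (N + k) = ((-1) ^ (N - k) * ((-1) ^ 2) ^ k :: rat)"
    unfolding power_mult[symmetric] power_add[symmetric] using assms by (simp add: add.commute)
  then have 1: "(-1) ^ (N - k) = ((-1) ^ (N + k) :: rat)"
    by simp
  have 2: "of_nat ((3 * k) choose k) = (fact (3 * k) / (fact k * fact (2 * k)) :: rat)"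
    using binomial_fact[of k "3 * k", where ?'a = rat] unfolding sub by simp
  have 3: "of_nat ((2 * k) choose k) = (fact (2 * k) / (fact k * fact k) :: rat)"
    using binomial_fact[of k "2 * k", where ?'a = rat] unfolding sub by simp
  have 4: "of_nat (N choose (3 * k)) = (fact N / (fact (3 * k) * fact (N - 3 * k)) :: rat)"
    using binomial_fact[of "3 * k" N, where ?'a = rat] assms by simp
  have 5: "of_nat ((N + k) choose k) = (fact (N + k) / (fact k * fact N) :: rat)"
    using binomial_fact[of k "N + k", where ?'a = rat] unfolding sub by simp
  have "of_int (az_term N k) = ((-1) ^ (N - k) * of_nat ((3 * k) choose k) * of_nat ((2 * k) choose k)
      * of_nat (N choose (3 * k)) * of_nat ((N + k) choose k) * 3 ^ (N - 3 * k) :: rat)"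
    by (simp add: az_term_def)
  then show ?thesis
    unfolding 1 2 3 4 5 by (simp add: power4_eq_xxxx mult_ac)
qed

lemma az_term_Suc:
  "of_int (az_term N (Suc k)) * (27 * (of_nat k + 1) ^ 4)
     = (of_int (az_term N k) * (- of_nat N + of_nat (3 * k)) * (- of_nat N + of_nat (3 * k) + 1)
         * (- of_nat N + of_nat (3 * k) + 2) * (of_nat N + of_nat k + 1) :: rat)"
proof (cases "3 * Suc k \<le> N")
  case True
  then obtain d where N: "N = 3 * k + 3 + d"
    by (metis add.assoc le_Suc_ex mult_Suc_right add.commute)
  have d: "N - 3 * Suc k = d" "N - 3 * k = Suc (Suc (Suc d))"
    using N by simp_all
  have k1: "(of_nat k + 1 :: rat) \<noteq> 0"
    using of_nat_neq_0[of k, where ?'a = rat] by (simp add: add.commute)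
  have d1: "(of_nat d + 1 :: rat) \<noteq> 0" "(of_nat d + 2 :: rat) \<noteq> 0" "(of_nat d + 3 :: rat) \<noteq> 0"
    using of_nat_neq_0[of d, where ?'a = rat] of_nat_neq_0[of "Suc d", where ?'a = rat]
      of_nat_neq_0[of "Suc (Suc d)", where ?'a = rat] by (simp_all add: add.commute)
  define s f g h t where "s = ((-1) ^ (N + k) :: rat)" and "f = (fact (N + k) :: rat)"
    and "g = (fact k :: rat)" and "h = (fact d :: rat)" and "t = (3 ^ d :: rat)"
  have nz: "g \<noteq> 0" "h \<noteq> 0" by (simp_all add: g_def h_def)
  have 1: "of_int (az_term N (Suc k))
      = - s * t * ((of_nat N + of_nat k + 1) * f) / (((of_nat k + 1) * g) ^ 4 * h)"
    using az_term_fact[OF True] unfolding d s_def f_def g_def h_def t_def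
    by (simp add: add_ac)
  have 2: "of_int (az_term N k)
      = s * (27 * t) * f / (g ^ 4 * ((of_nat d + 3) * ((of_nat d + 2) * ((of_nat d + 1) * h))))"
    using az_term_fact[of k N] True unfolding d s_def f_def g_def h_def t_def
    by (simp add: add_ac)
  define D where "D = (of_nat d + 3) * ((of_nat d + 2) * (of_nat d + 1 :: rat))"
  define l where "l = (of_nat k + 1 :: rat)"
  have nz': "D \<noteq> 0" "l \<noteq> 0"
    using k1 d1 by (simp_all add: D_def l_def)
  have N': "(of_nat N :: rat) = 3 * of_nat k + 3 + of_nat d"
    unfolding N by simp
  have 3: "(- of_nat N + of_nat (3 * k)) * (- of_nat N + of_nat (3 * k) + 1)
         * (- of_nat N + of_nat (3 * k) + 2) = - D"
    unfolding N' D_def by (simp add: algebra_simps)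
  have "of_int (az_term N (Suc k)) * (27 * l ^ 4)
      = - s * t * ((of_nat N + of_nat k + 1) * f) / ((l * g) ^ 4 * h) * (27 * l ^ 4)"
    unfolding 1 l_def ..
  also have "\<dots> = s * (27 * t) * f / (g ^ 4 * (D * h)) * (- D) * (of_nat N + of_nat k + 1)"
    using nz nz' by (simp add: field_simps power_mult_distrib)
  also have "\<dots> = of_int (az_term N k) * (- D) * (of_nat N + of_nat k + 1)"
    unfolding 2 D_def by (simp add: mult.assoc)
  finally show ?thesis
    unfolding 3[symmetric] l_def by (simp only: mult.assoc)
next
  case False
  \<comment> \<open>Here the next term is zero, and on the right either \<open>az_term N k\<close>
    or one of the three factors in N - 3k vanishes.\<close>
  then have "N < 3 * k \<or> N = 3 * k \<or> N = 3 * k + 1 \<or> N = 3 * k + 2"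
    by presburger
  moreover have "az_term N (Suc k) = 0"
    using False by (simp add: az_term_eq_0)
  ultimately show ?thesis
    by (elim disjE) (simp_all add: az_term_eq_0)
qed

text \<open>Iterates the term ratio. For N = pn and k = pj the Pochhammer arguments become -p(n -
  3j), 1 + p(n + j) and 1 + pj, which are p-adically close to 0 and 1.\<close>

lemma az_term_add:
  "of_int (az_term N (k + r)) = (of_int (az_term N k)
     * pochhammer (- of_nat N + 3 * of_nat k) (3 * r) * pochhammer (of_nat (N + k) + 1) r
     / (27 ^ r * pochhammer (of_nat k + 1) r ^ 4) :: rat)"
proof (induction r)
  case 0
  then show ?case by simp
next
  case (Suc r)
  have nz: "pochhammer (of_nat k + 1 :: rat) r \<noteq> 0" for r
  proof -
    have "pochhammer (of_nat (Suc k) :: rat) r \<noteq> 0"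
      using pochhammer_pos[of "of_nat (Suc k) :: rat" r] by simp
    then show ?thesis by (simp add: add.commute)
  qed
  have nz2: "(of_nat k + of_nat r + 1 :: rat) \<noteq> 0"
    using of_nat_neq_0[of "k + r", where ?'a = rat] by (simp add: add_ac)
  define A B C where "A = pochhammer (- of_nat N + 3 * of_nat k :: rat) (3 * r)"
    and "B = pochhammer (of_nat (N + k) + 1 :: rat) r" and "C = pochhammer (of_nat k + 1 :: rat) r"
  have "C \<noteq> 0" unfolding C_def by (rule nz)
  have IH: "of_int (az_term N (k + r)) = of_int (az_term N k) * A * B / (27 ^ r * C ^ 4)"
    using Suc.IH by (simp add: A_def B_def C_def)
  define X Y L where "X = - of_nat N + 3 * of_nat k + (of_nat (3 * r) :: rat)"
    and "Y = of_nat (N + k) + 1 + (of_nat r :: rat)" and "L = of_nat k + 1 + (of_nat r :: rat)"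
  have XYL: "- of_nat N + of_nat (3 * (k + r)) = X" "of_nat N + of_nat (k + r) + 1 = Y"
    "of_nat (k + r) + 1 = L"
    by (simp_all add: X_def Y_def L_def)
  have "L \<noteq> 0"
    using nz2 by (simp add: L_def add_ac)
  have "of_int (az_term N (k + Suc r)) * (27 * L ^ 4)
     = of_int (az_term N k) * A * B / (27 ^ r * C ^ 4) * X * (X + 1) * (X + 2) * Y"
    using az_term_Suc[of N "k + r"] unfolding IH XYL by simp
  also have "\<dots> = of_int (az_term N k) * (A * X * (X + 1) * (X + 2)) * (B * Y)
        / (27 * 27 ^ r * (C * L) ^ 4) * (27 * L ^ 4)"
    using \<open>L \<noteq> 0\<close> \<open>C \<noteq> 0\<close> by (simp add: power_mult_distrib)
  finally have "of_int (az_term N (k + Suc r))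
     = of_int (az_term N k) * (A * X * (X + 1) * (X + 2)) * (B * Y) / (27 * 27 ^ r * (C * L) ^ 4)"
    by (rule mult_right_cancel[THEN iffD1, rotated]) (use \<open>L \<noteq> 0\<close> in simp)
  then show ?case
    unfolding A_def B_def C_def X_def Y_def L_def by (simp only: pochhammer_3_Suc pochhammer_Suc power_Suc)
qed

text \<open>The coefficient of \<open>x\<close> in \<open>pochhammer (1 + x) s\<close>, that is \<open>s!\<close> times the harmonic number \<open>H_s\<close>.\<close>
primrec poch_lin :: "nat \<Rightarrow> nat" where
  "poch_lin 0 = 0"
| "poch_lin (Suc s) = Suc s * poch_lin s + fact s"

section \<open>Congruences between p-integral rationals\<close>

locale prime_ge_5 =
  fixes p :: nat
  assumes prime_p: "prime p" and p_ge_5: "p \<ge> 5"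
begin

text \<open>\<open>pdvd k x\<close>: the p-adic valuation of \<open>x\<close> is at least \<open>k\<close>; \<open>pdvd 0\<close> is p-integrality.\<close>
definition pdvd :: "nat \<Rightarrow> rat \<Rightarrow> bool" where
  "pdvd k x \<longleftrightarrow> (\<exists>a b. \<not> int p dvd b \<and> x * of_int b = of_nat p ^ k * of_int a)"

abbreviation pcong :: "nat \<Rightarrow> rat \<Rightarrow> rat \<Rightarrow> bool" where
  "pcong k x y \<equiv> pdvd k (x - y)"

text \<open>The first conjunct excludes zero, which would pass the other two because
  \<open>1 / 0 = 0\<close>.\<close>

definition punit :: "rat \<Rightarrow> bool" where
  "punit u \<longleftrightarrow> u \<noteq> 0 \<and> pdvd 0 u \<and> pdvd 0 (1 / u)"

lemma prime_int_p: "prime (int p)"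
  using prime_p by simp

lemma p_pos: "p > 0"
  using p_ge_5 by simp

lemma odd_p: "odd p"
  using prime_p p_ge_5 prime_odd_nat by simp

lemma pdvd_add:
  assumes "pdvd k x" "pdvd k y"
  shows "pdvd k (x + y)"
proof -
  obtain a b where 1: "\<not> int p dvd b" "x * of_int b = of_nat p ^ k * of_int a"
    using assms unfolding pdvd_def by blast
  obtain c d where 2: "\<not> int p dvd d" "y * of_int d = of_nat p ^ k * of_int c"
    using assms unfolding pdvd_def by blast
  have "(x + y) * of_int (b * d) = (x * of_int b) * of_int d + (y * of_int d) * of_int b"
    by (simp add: algebra_simps)
  also have "\<dots> = of_nat p ^ k * of_int (a * d + c * b)"
    by (simp add: 1 2 algebra_simps)
  finally show ?thesis
    using 1(1) 2(1) prime_dvd_mult_iff[OF prime_int_p] unfolding pdvd_def by blast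
qed

lemma pdvd_mult:
  assumes "pdvd k x" "pdvd l y"
  shows "pdvd (k + l) (x * y)"
proof -
  obtain a b where 1: "\<not> int p dvd b" "x * of_int b = of_nat p ^ k * of_int a"
    using assms unfolding pdvd_def by blast
  obtain c d where 2: "\<not> int p dvd d" "y * of_int d = of_nat p ^ l * of_int c"
    using assms unfolding pdvd_def by blast
  have "(x * y) * of_int (b * d) = (x * of_int b) * (y * of_int d)"
    by (simp add: algebra_simps)
  also have "\<dots> = of_nat p ^ (k + l) * of_int (a * c)"
    by (simp add: 1 2 algebra_simps power_add)
  finally show ?thesis
    using 1(1) 2(1) prime_dvd_mult_iff[OF prime_int_p] unfolding pdvd_def by blast
qed

text \<open>The bridge back to the integers: the denominator is prime to \<open>p\<close>, hence
  coprime to \<open>p ^ k\<close>, and can be cancelled.\<close>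

lemma pdvd_of_int_iff: "pdvd k (of_int z) \<longleftrightarrow> int p ^ k dvd z"
proof
  assume "pdvd k (of_int z)"
  then obtain a b where 1: "\<not> int p dvd b"
    "(of_int z :: rat) * of_int b = of_nat p ^ k * of_int a"
    unfolding pdvd_def by blast
  from 1(2) have "(of_int (z * b) :: rat) = of_int (int p ^ k * a)"
    by simp
  then have "z * b = int p ^ k * a"
    by (simp only: of_int_eq_iff)
  then have "int p ^ k dvd z * b"
    by simp
  moreover have "coprime (int p ^ k) b"
    using prime_imp_coprime[OF prime_int_p 1(1)] by simp
  ultimately show "int p ^ k dvd z"
    using coprime_dvd_mult_left_iff by blast
next
  assume "int p ^ k dvd z"
  then obtain c where "z = int p ^ k * c" by blast
  then show "pdvd k (of_int z)"
    unfolding pdvd_def using p_ge_5 by (intro exI[of _ c] exI[of _ 1]) auto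
qed

lemma pdvd_0_of_int [simp]: "pdvd 0 (of_int z)"
  by (simp add: pdvd_of_int_iff)

lemma pdvd_0_of_nat [simp]: "pdvd 0 (of_nat n)"
  using pdvd_0_of_int[of "int n"] by simp

lemma pdvd_0_numeral [simp]: "pdvd 0 (numeral n)"
  using pdvd_0_of_nat[of "numeral n"] by simp

lemma pdvd_0_1 [simp]: "pdvd 0 1"
  using pdvd_0_of_nat[of 1] by simp

lemma pdvd_0_fact [simp]: "pdvd 0 (fact n)"
  using pdvd_0_of_nat[of "fact n"] by simp

lemma pdvd_zero [simp]: "pdvd k 0"
  using pdvd_of_int_iff[of k 0] by simp

lemma pdvd_p_power [simp]: "pdvd k (of_nat p ^ k)"
  using pdvd_of_int_iff[of k "int p ^ k"] by simp

lemma pdvd_p [simp]: "pdvd (Suc 0) (of_nat p)"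
  using pdvd_p_power[of 1] by simp

lemma pdvd_mult_left: "pdvd 0 x \<Longrightarrow> pdvd k y \<Longrightarrow> pdvd k (x * y)"
  using pdvd_mult[of 0 x k y] by simp

lemma pdvd_mult_right: "pdvd k x \<Longrightarrow> pdvd 0 y \<Longrightarrow> pdvd k (x * y)"
  using pdvd_mult[of k x 0 y] by simp

lemma pdvd_minus: "pdvd k x \<Longrightarrow> pdvd k (- x)"
  using pdvd_mult_left[of "of_int (- 1)" k x] pdvd_0_of_int[of "-1"] by simp

lemma pdvd_diff: "pdvd k x \<Longrightarrow> pdvd k y \<Longrightarrow> pdvd k (x - y)"
  using pdvd_add[of k x "- y"] pdvd_minus by simp

lemma pdvd_mono: "pdvd k x \<Longrightarrow> l \<le> k \<Longrightarrow> pdvd l x"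
proof -
  assume "pdvd k x" "l \<le> k"
  then obtain a b where 1: "\<not> int p dvd b" "x * of_int b = of_nat p ^ k * of_int a"
    unfolding pdvd_def by blast
  have "x * of_int b = of_nat p ^ l * of_int (int p ^ (k - l) * a)"
    using 1(2) \<open>l \<le> k\<close> by (simp add: power_add[symmetric])
  then show ?thesis
    using 1(1) unfolding pdvd_def by blast
qed

lemma pdvd_0: "pdvd k x \<Longrightarrow> pdvd 0 x"
  using pdvd_mono by blast

lemma pdvd_power: "pdvd 0 x \<Longrightarrow> pdvd 0 (x ^ n)"
  by (induction n) (auto intro: pdvd_mult_left)

lemma pdvd_sum: "(\<And>i. i \<in> A \<Longrightarrow> pdvd k (f i)) \<Longrightarrow> pdvd k (sum f A)"
  by (induction A rule: infinite_finite_induct) (auto intro: pdvd_add)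

lemma pdvd_prod: "(\<And>i. i \<in> A \<Longrightarrow> pdvd 0 (f i)) \<Longrightarrow> pdvd 0 (prod f A)"
  by (induction A rule: infinite_finite_induct) (auto intro: pdvd_mult_left)

lemmas pdvd_intros = pdvd_add pdvd_mult_left pdvd_minus pdvd_diff pdvd_power pdvd_sum pdvd_prod

section \<open>Calculus of p-adic congruences\<close>

lemma pcong_sym: "pcong k x y \<Longrightarrow> pcong k y x"
  using pdvd_minus[of k "x - y"] by simp

lemma pcong_trans [trans]: "pcong k x y \<Longrightarrow> pcong k y z \<Longrightarrow> pcong k x z"
  using pdvd_add[of k "x - y" "y - z"] by simp

lemma pcong_refl [simp]: "pcong k x x"
  by simp

lemma pcong_integral: "pcong k x y \<Longrightarrow> pdvd 0 y \<Longrightarrow> pdvd 0 x"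
  using pdvd_add[of 0 "x - y" y] pdvd_0[of k "x - y"] by simp

lemma pcong_add: "pcong k x y \<Longrightarrow> pcong k x' y' \<Longrightarrow> pcong k (x + x') (y + y')"
  using pdvd_add[of k "x - y" "x' - y'"] by (simp add: algebra_simps)

lemma pcong_mult:
  assumes "pcong k x y" "pcong k x' y'" "pdvd 0 y" "pdvd 0 y'"
  shows "pcong k (x * x') (y * y')"
proof -
  have "pdvd 0 x'"
    using assms pcong_integral by blast
  then have "pdvd k ((x - y) * x' + y * (x' - y'))"
    using assms by (intro pdvd_add pdvd_mult_right[of k "x - y"] pdvd_mult_left)
  then show ?thesis
    by (simp add: algebra_simps)
qed

lemma pcong_power: "pcong k x y \<Longrightarrow> pdvd 0 y \<Longrightarrow> pcong k (x ^ n) (y ^ n)"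
  by (induction n) (auto intro: pcong_mult pdvd_power)

lemma pcong_sum: "(\<And>i. i \<in> A \<Longrightarrow> pcong k (f i) (g i)) \<Longrightarrow> pcong k (sum f A) (sum g A)"
  using pdvd_sum[of A k "\<lambda>i. f i - g i"] by (simp add: sum_subtractf)

lemma pcong_prod:
  "(\<And>i. i \<in> A \<Longrightarrow> pcong k (f i) (g i)) \<Longrightarrow> (\<And>i. i \<in> A \<Longrightarrow> pdvd 0 (g i))
     \<Longrightarrow> pcong k (prod f A) (prod g A)"
  by (induction A rule: infinite_finite_induct) (auto intro!: pcong_mult pdvd_prod)

section \<open>Units among the p-integral rationals\<close>

lemma punit_of_int: "\<not> int p dvd b \<Longrightarrow> punit (of_int b)"
  unfolding punit_def
proof (intro conjI)
  assume b: "\<not> int p dvd b"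
  then show nz: "of_int b \<noteq> (0::rat)" by auto
  have "1 / of_int b * of_int b = (of_nat p ^ 0 * of_int 1 :: rat)"
    using nz by simp
  then show "pdvd 0 (1 / of_int b)"
    using b unfolding pdvd_def by blast
qed simp

lemma punit_of_nat: "\<not> p dvd b \<Longrightarrow> punit (of_nat b)"
  using punit_of_int[of "int b"] by simp

lemma punit_of_nat_less: "n < p \<Longrightarrow> 0 < n \<Longrightarrow> punit (of_nat n)"
  by (rule punit_of_nat) (auto dest: dvd_imp_le)

lemma punit_2: "punit 2" and punit_3: "punit 3"
  using punit_of_nat_less[of 2] punit_of_nat_less[of 3] p_ge_5 by simp_all

lemma punit_nz: "punit u \<Longrightarrow> u \<noteq> 0"
  by (simp add: punit_def)

lemma punit_integral: "punit u \<Longrightarrow> pdvd 0 u"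
  by (simp add: punit_def)

lemma punit_mult: "punit u \<Longrightarrow> punit v \<Longrightarrow> punit (u * v)"
  using pdvd_mult_left[of "1 / u" 0 "1 / v"] by (simp add: punit_def pdvd_mult_left)

lemma punit_power: "punit u \<Longrightarrow> punit (u ^ n)"
  using pdvd_power[of "1 / u" n] by (simp add: punit_def pdvd_power power_one_over)

lemma punit_fact: "r < p \<Longrightarrow> punit (fact r)"
  using punit_of_nat[of "fact r"] prime_dvd_fact_iff[OF prime_p] by simp

lemma pdvd_divide: "pdvd k x \<Longrightarrow> punit u \<Longrightarrow> pdvd k (x / u)"
  using pdvd_mult_right[of k x "1 / u"] by (simp add: punit_def)

lemma punit_cancel:
  assumes "punit u" "pdvd k (u * x)"
  shows "pdvd k x"
  using pdvd_divide[OF assms(2,1)] punit_nz[OF assms(1)] by simp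

lemma pcong_cancel:
  assumes "punit u" "pcong k (u * x) (u * y)"
  shows "pcong k x y"
  using punit_cancel[of u k "x - y"] assms by (simp add: algebra_simps)

text \<open>The quotient x/y has the form (d + pc)/d with d prime to \<open>p\<close>, so its
  numerator is prime to \<open>p\<close> as well.\<close>

lemma punit_pcong:
  assumes "pcong (Suc k) x y" "punit y"
  shows "punit x"
proof -
  obtain a b where y: "y \<noteq> 0" "\<not> int p dvd b" "1 / y * of_int b = of_int a"
    using assms(2) unfolding punit_def pdvd_def by auto
  have "pdvd 1 (x / y - 1)"
    using pdvd_divide[OF pdvd_mono[OF assms(1), of 1] assms(2)] y(1)
    by (simp add: diff_divide_distrib)
  then obtain c d where 1: "\<not> int p dvd d" "(x / y - 1) * of_int d = of_nat p * of_int c"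
    unfolding pdvd_def by auto
  have xy: "x / y * of_int d = of_int (d + int p * c)"
    using 1 by (simp add: algebra_simps)
  have nd: "\<not> int p dvd d + int p * c"
    using 1(1) by (simp add: dvd_add_left_iff)
  then have nz: "d + int p * c \<noteq> 0"
    by force
  then have x0: "x \<noteq> 0"
    using xy by force
  have "y / x = of_int d / of_int (d + int p * c)"
    using xy x0 y(1) nz by (simp add: field_simps del: of_int_add of_int_mult)
  then have "pdvd 0 (y / x)"
    using pdvd_divide[OF pdvd_0_of_int punit_of_int[OF nd]] by simp
  then have "pdvd 0 (1 / x)"
    using pdvd_divide[of 0 "y / x" y] assms(2) y(1) by simp
  then show ?thesis
    using x0 pcong_integral[OF assms(1)] punit_integral[OF assms(2)] by (simp add: punit_def)
qed


section \<open>Wolstenholme and Ljunggren congruences\<close>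

text \<open>Doubling permutes the nonzero residues, so the sum \<open>S\<close> satisfies \<open>S \<equiv> 4 S\<close> modulo \<open>p\<close>.\<close>
lemma sum_inverse_squares: "pdvd 1 (\<Sum>i\<in>{1..<p}. 1 / of_nat i ^ 2)"
proof -
  define S where "S = (\<Sum>i\<in>{1..<p}. 1 / of_nat i ^ 2 :: rat)"
  have "pcong 1 (1 / of_nat i ^ 2) (4 / of_nat (2 * i mod p) ^ 2)" if i: "i \<in> {1..<p}" for i
  proof -
    define j where "j = 2 * i mod p"
    have j: "j \<in> {1..<p}"
      using bij_betw_apply[OF bij_betw_double_mod[OF odd_p] i] by (simp add: j_def)
    have u: "punit (of_nat i)" "punit (of_nat j)"
      using i j by (auto intro: punit_of_nat_less)
    have "2 * i = j + p * (2 * i div p)"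
      by (simp add: j_def)
    then obtain q where "2 * i = j + p * q" by blast
    then have "(of_nat (2 * i) :: rat) = of_nat (j + p * q)"
      by (simp only:)
    then have q: "2 * of_nat i = (of_nat j + of_nat p * of_nat q :: rat)"
      by simp
    have "1 / of_nat i ^ 2 - 4 / of_nat j ^ 2
        = ((of_nat j - 2 * of_nat i) * (of_nat j + 2 * of_nat i)) / (of_nat i ^ 2 * of_nat j ^ 2 :: rat)"
      using u[THEN punit_nz] by (simp add: field_simps power2_eq_square)
    also have "of_nat j - 2 * of_nat i = (of_nat p * (- of_nat q) :: rat)"
      using q by simp
    finally have eq: "1 / of_nat i ^ 2 - 4 / of_nat j ^ 2
        = of_nat p * (- of_nat q * (of_nat j + 2 * of_nat i)) / (of_nat i ^ 2 * of_nat j ^ 2 :: rat)"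
      by simp
    have "pdvd 0 (- of_nat q * (of_nat j + 2 * of_nat i))"
      by (intro pdvd_intros) auto
    from pdvd_mult_right[OF pdvd_p this]
    have "pdvd 1 (of_nat p * (- of_nat q * (of_nat j + 2 * of_nat i)))"
      by (simp only: One_nat_def)
    then show ?thesis
      unfolding j_def[symmetric] eq using u by (intro pdvd_divide punit_mult punit_power)
  qed
  then have "pcong 1 S (\<Sum>i\<in>{1..<p}. 4 / of_nat (2 * i mod p) ^ 2)"
    unfolding S_def by (rule pcong_sum)
  also have "(\<Sum>i\<in>{1..<p}. 4 / of_nat (2 * i mod p) ^ 2) = (\<Sum>i\<in>{1..<p}. 4 / of_nat i ^ 2 :: rat)"
    by (rule sum.reindex_bij_betw[OF bij_betw_double_mod[OF odd_p]])
  also have "\<dots> = 4 * S"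
    by (simp add: S_def sum_distrib_left)
  \<comment> \<open>The difference \<open>S - 4 * S\<close> is \<open>- 3 * S\<close>, and 3 is
    invertible because \<open>p \<ge> 5\<close>.\<close>
  finally have "pdvd 1 (3 * S)"
    using pdvd_minus[of 1 "S - 4 * S"] by simp
  then show ?thesis
    unfolding S_def by (rule punit_cancel[OF punit_3])
qed

text \<open>Every product of two of the terms \<open>of_nat p ^ 2 * c i\<close> carries p^4.\<close>

lemma prod_one_plus_p_squared:
  assumes "finite A" "\<And>i. i \<in> A \<Longrightarrow> pdvd 0 (c i)"
  shows "pcong 3 (\<Prod>i\<in>A. 1 + of_nat p ^ 2 * c i) (1 + of_nat p ^ 2 * (\<Sum>i\<in>A. c i))"
  using assms
proof (induction A rule: finite_induct)
  case empty
  then show ?case by simp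
next
  case (insert i A)
  define S where "S = (\<Sum>i\<in>A. c i)"
  have S: "pdvd 0 S" "pdvd 0 (c i)"
    using insert by (auto simp: S_def intro: pdvd_sum)
  have "pcong 3 (\<Prod>i\<in>A. 1 + of_nat p ^ 2 * c i) (1 + of_nat p ^ 2 * S)"
    using insert by (simp add: S_def)
  then have "pcong 3 ((1 + of_nat p ^ 2 * c i) * (\<Prod>i\<in>A. 1 + of_nat p ^ 2 * c i))
      ((1 + of_nat p ^ 2 * c i) * (1 + of_nat p ^ 2 * S))"
    using S by (intro pcong_mult) (auto intro!: pdvd_add pdvd_mult_left pdvd_power)
  moreover have "pcong 3 ((1 + of_nat p ^ 2 * c i) * (1 + of_nat p ^ 2 * S)) (1 + of_nat p ^ 2 * (c i + S))"
  proof -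
    have "pdvd 3 (of_nat p ^ 3 * (of_nat p * c i * S))"
      using S by (intro pdvd_mult_right[OF pdvd_p_power] pdvd_intros) auto
    then show ?thesis
      by (simp add: algebra_simps power2_eq_square power3_eq_cube)
  qed
  ultimately show ?case
    using insert pcong_trans by (simp add: S_def)
qed

text \<open>
  Pairing \<open>i\<close> with \<open>p - i\<close> in the square of the left-hand side gives factors
  \<open>i (p - i) + p^2 x (x + 1)\<close>; squaring avoids choosing one index from each pair.
\<close>
lemma pochhammer_p_minus_1:
  assumes x: "pdvd 0 x"
  shows "pcong 3 (pochhammer (1 + of_nat p * x) (p - 1)) (fact (p - 1))"
proof -
  define P where "P = (of_nat p :: rat)"
  define f where "f = (\<lambda>x. pochhammer (1 + P * x) (p - 1))"
  define w where "w = (fact (p - 1) :: rat)"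
  define t where "t = (\<lambda>i. 1 / (of_nat i * (P - of_nat i)))"
  have f_prod: "f x = (\<Prod>i\<in>{1..<p}. of_nat i + P * x)" for x
  proof -
    have "f x = (\<Prod>i\<in>{0..<p - 1}. 1 + P * x + of_nat i)"
      by (simp add: f_def pochhammer_prod)
    also have "\<dots> = (\<Prod>i\<in>{1..<p}. of_nat i + P * x)"
      by (rule prod.reindex_bij_witness[of _ "\<lambda>i. i - 1" Suc]) auto
    finally show ?thesis .
  qed
  have f_prod': "f x = (\<Prod>i\<in>{1..<p}. P - of_nat i + P * x)" for x
    unfolding f_prod
    by (rule prod.reindex_bij_witness[of _ "\<lambda>i. p - i" "\<lambda>i. p - i"]) (auto simp: P_def of_nat_diff)
  have f0: "f 0 = w"
    by (simp add: f_def w_def pochhammer_fact)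
  have sq: "f x ^ 2 = (\<Prod>i\<in>{1..<p}. of_nat i * (P - of_nat i) + P ^ 2 * (x * (x + 1)))" for x
  proof -
    have "f x * f x = (\<Prod>i\<in>{1..<p}. (of_nat i + P * x) * (P - of_nat i + P * x))"
      unfolding prod.distrib by (subst f_prod, subst f_prod') rule
    also have "\<dots> = (\<Prod>i\<in>{1..<p}. of_nat i * (P - of_nat i) + P ^ 2 * (x * (x + 1)))"
      by (intro prod.cong) (auto simp: algebra_simps power2_eq_square)
    finally show ?thesis
      by (simp add: power2_eq_square)
  qed
  have unit: "punit (of_nat i)" "punit (P - of_nat i)" if "i \<in> {1..<p}" for i
    using that punit_of_nat_less[of i] punit_of_nat_less[of "p - i"] by (auto simp: P_def of_nat_diff)
  have t: "pdvd 0 (t i)" if "i \<in> {1..<p}" for i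
    using unit[OF that] by (auto simp: t_def intro!: pdvd_divide punit_mult)
  have w: "punit w"
    using p_pos by (simp add: w_def punit_fact)
  have "f x ^ 2 = w ^ 2 * (\<Prod>i\<in>{1..<p}. 1 + P ^ 2 * (x * (x + 1) * t i))"
    unfolding f0[symmetric] sq prod.distrib[symmetric] t_def
    using unit[THEN punit_nz] by (intro prod.cong) (auto simp: field_simps)
  moreover have "pcong 3 \<dots> (w ^ 2 * 1)"
  proof (intro pcong_mult pcong_refl)
    have "pcong 3 (\<Prod>i\<in>{1..<p}. 1 + P ^ 2 * (x * (x + 1) * t i))
        (1 + P ^ 2 * (\<Sum>i\<in>{1..<p}. x * (x + 1) * t i))"
      unfolding P_def using x t[unfolded P_def]
      by (intro prod_one_plus_p_squared) (auto intro!: pdvd_intros)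
    \<comment> \<open>The third factor \<open>p\<close> comes from the sum: \<open>t i\<close> is
      congruent to -1/i^2 modulo \<open>p\<close>, so \<open>sum_inverse_squares\<close>
      applies.\<close>
    moreover have "pdvd 3 (P ^ 2 * (\<Sum>i\<in>{1..<p}. x * (x + 1) * t i))"
    proof -
      have "pcong 1 (t i) (- (1 / of_nat i ^ 2))" if "i \<in> {1..<p}" for i
      proof -
        have "t i - (- (1 / of_nat i ^ 2)) = P / (of_nat i ^ 2 * (P - of_nat i))"
          using unit[OF that, THEN punit_nz] by (simp add: t_def field_simps power2_eq_square)
        then show ?thesis
          using unit[OF that] by (auto simp: P_def intro!: pdvd_divide punit_mult punit_power)
      qed
      then have "pcong 1 (\<Sum>i\<in>{1..<p}. t i) (\<Sum>i\<in>{1..<p}. - (1 / of_nat i ^ 2))"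
        by (rule pcong_sum)
      then have "pdvd 1 (\<Sum>i\<in>{1..<p}. t i)"
        using pdvd_diff[OF _ sum_inverse_squares, of "(\<Sum>i\<in>{1..<p}. t i) + (\<Sum>i\<in>{1..<p}. 1 / of_nat i ^ 2)"]
        by (simp add: sum_negf del: One_nat_def)
      then have "pdvd (2 + 1) (P ^ 2 * (x * (x + 1) * (\<Sum>i\<in>{1..<p}. t i)))"
        unfolding P_def using x by (intro pdvd_mult pdvd_p_power pdvd_mult_left) (auto intro!: pdvd_intros)
      then show ?thesis
        by (simp add: sum_distrib_left numeral_3_eq_3)
    qed
    ultimately show "pcong 3 (\<Prod>i\<in>{1..<p}. 1 + P ^ 2 * (x * (x + 1) * t i)) 1"
      using pdvd_add by fastforce
  qed (use w in \<open>auto intro: punit_integral punit_power\<close>)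
  ultimately have sqc: "pcong 3 (f x ^ 2) (w ^ 2)"
    by simp
  \<comment> \<open>To pass from the squares to the values, divide by \<open>f x + w\<close>, which
    is congruent to the unit 2w modulo \<open>p\<close>.\<close>
  have "pcong 1 (f x) w"
    unfolding f0[symmetric] f_prod P_def using x
    by (intro pcong_prod) (auto intro!: pdvd_mult_right)
  then have "pcong 1 (f x + w) (w + w)"
    by simp
  then have "punit (f x + w)"
    using punit_pcong[of 0 "f x + w" "2 * w"] punit_mult[OF punit_2 w] by simp
  moreover have "pdvd 3 ((f x + w) * (f x - w))"
    using sqc by (simp add: algebra_simps power2_eq_square)
  ultimately show ?thesis
    unfolding f_def w_def P_def by (rule punit_cancel)
qed

section \<open>The part of (pa)! prime to p, and congruences of Ljunggren type\<close>

definition fact_unit :: "nat \<Rightarrow> rat" where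
  "fact_unit a = (\<Prod>c<a. pochhammer (1 + of_nat p * of_nat c) (p - 1))"

text \<open>The multiples of \<open>p\<close> up to pa contribute p^a a!; \<open>fact_unit\<close>
  collects the other factors, one run between consecutive multiples for each
  \<open>c\<close>.\<close>

lemma fact_p_mult: "fact (p * a) = of_nat p ^ a * fact a * fact_unit a"
proof (induction a)
  case 0
  then show ?case by (simp add: fact_unit_def)
next
  case (Suc a)
  have "fact (p * Suc a) = (pochhammer 1 (p * a + p) :: rat)"
    by (simp add: pochhammer_fact add.commute)
  also have "\<dots> = fact (p * a) * pochhammer (1 + of_nat p * of_nat a) p"
    by (simp add: pochhammer_product' pochhammer_fact)
  also have "pochhammer (1 + of_nat p * of_nat a) p
      = pochhammer (1 + of_nat p * of_nat a) (p - 1) * (of_nat p * of_nat (Suc a) :: rat)"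
    using pochhammer_Suc[of "1 + of_nat p * of_nat a :: rat" "p - 1"] p_pos
    by (simp add: of_nat_diff algebra_simps)
  finally show ?case
    unfolding Suc.IH by (simp add: fact_unit_def algebra_simps)
qed

lemma punit_fact_p_minus_1: "punit (fact (p - 1))"
  using p_pos by (simp add: punit_fact)

text \<open>Modulo p^3 the unit part becomes a pure power, so unit parts cancel in any quotient of
  factorials whose arguments balance.\<close>

lemma fact_unit_cong: "pcong 3 (fact_unit a) (fact (p - 1) ^ a)"
proof -
  have "pcong 3 (fact_unit a) (\<Prod>c<a. fact (p - 1))"
    unfolding fact_unit_def by (intro pcong_prod pochhammer_p_minus_1) auto
  then show ?thesis by simp
qed

lemma punit_fact_unit: "punit (fact_unit a)"
  using punit_pcong[of 2 "fact_unit a" "fact (p - 1) ^ a"] fact_unit_cong[of a]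
    punit_power[OF punit_fact_p_minus_1] by simp

text \<open>Since 2m = m + m, the powers of \<open>p\<close> cancel exactly and the unit parts
  cancel modulo p^3.\<close>

lemma central_binomial_cong: "pcong 3 (of_nat ((2 * (p * m)) choose (p * m))) (of_nat ((2 * m) choose m))"
proof -
  have bin: "(of_nat ((2 * k) choose k) :: rat) * fact k ^ 2 = fact (2 * k)" for k
    using binomial_fact[of k "2 * k", where ?'a = rat] by (simp add: power2_eq_square mult_2)
  have "fact (p * m) ^ 2 = fact_unit m ^ 2 * (of_nat p ^ m * fact m) ^ 2"
    by (simp add: fact_p_mult power_mult_distrib)
  moreover have "fact (2 * (p * m)) = (fact (p * (2 * m)) :: rat)"
    by (simp add: mult.left_commute)
  ultimately have "(of_nat ((2 * (p * m)) choose (p * m)) :: rat) * fact_unit m ^ 2 * (of_nat p ^ m * fact m) ^ 2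
      = fact (p * (2 * m))"
    using bin[of "p * m"] by (simp only: mult.assoc)
  also have "\<dots> = of_nat p ^ (2 * m) * fact (2 * m) * fact_unit (2 * m)"
    by (rule fact_p_mult)
  also have "\<dots> = of_nat ((2 * m) choose m) * fact_unit (2 * m) * (of_nat p ^ m * fact m) ^ 2"
    unfolding bin[symmetric] by (simp add: power_mult_distrib power_mult[symmetric] mult_ac)
  finally have "fact_unit m ^ 2 * of_nat ((2 * (p * m)) choose (p * m)) = fact_unit (2 * m) * of_nat ((2 * m) choose m)"
    using p_pos by (simp add: mult_ac)
  moreover have "pcong 3 (fact_unit (2 * m)) (fact_unit m ^ 2)"
  proof -
    have "pcong 3 (fact_unit m ^ 2) ((fact (p - 1) ^ m) ^ 2)"
      by (intro pcong_power fact_unit_cong pdvd_intros) auto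
    then show ?thesis
      using fact_unit_cong[of "2 * m"] pcong_sym pcong_trans
      by (metis power_mult mult.commute)
  qed
  then have "pcong 3 (fact_unit (2 * m) * of_nat ((2 * m) choose m)) (fact_unit m ^ 2 * of_nat ((2 * m) choose m))"
    by (intro pcong_mult pcong_refl) (auto intro: punit_integral punit_power punit_fact_unit)
  ultimately show ?thesis
    using pcong_cancel[OF punit_power[OF punit_fact_unit]] by metis
qed

text \<open>With m = n - 3j, the balance n + j = 4j + m makes the powers of \<open>p\<close> agree
  and the unit parts cancel modulo p^3. The powers of 3 do not cancel and are
  cross-multiplied.\<close>

lemma az_term_cong:
  assumes "3 * j \<le> n"
  shows "pcong 3 (3 ^ (n - 3 * j) * of_int (az_term (p * n) (p * j)))
           (3 ^ (p * (n - 3 * j)) * of_int (az_term n j))"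
proof -
  define m where "m = n - 3 * j"
  have n: "n = 3 * j + m" using assms by (simp add: m_def)
  define W where "W = fact_unit j ^ 4 * fact_unit m"
  have sgn: "(-1) ^ (p * n + p * j) = ((-1) ^ (n + j) :: rat)"
    unfolding distrib_left[symmetric] power_mult using odd_p by simp
  define s where "s = ((-1) ^ (n + j) :: rat)"
  have pm: "p * n - 3 * (p * j) = p * m"
    by (simp add: n algebra_simps)
  have "p * n + p * j = p * (n + j)" by (simp add: algebra_simps)
  then have "of_int (az_term (p * n) (p * j))
      = s * 3 ^ (p * m) * fact (p * (n + j)) / (fact (p * j) ^ 4 * fact (p * m))"
    using az_term_fact[of "p * j" "p * n"] assms unfolding sgn s_def pm by simp
  also have "\<dots> = s * 3 ^ (p * m) * fact (n + j) * fact_unit (n + j) / (fact j ^ 4 * fact m * W)"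
  proof -
    have "(of_nat p ^ (n + j) :: rat) = (of_nat p ^ j) ^ 4 * of_nat p ^ m"
    proof -
      have "n + j = j * 4 + m" by (simp add: n)
      then show ?thesis by (simp only: power_add power_mult)
    qed
    then show ?thesis
      using p_pos by (simp add: fact_p_mult W_def power_mult_distrib) (simp add: mult_ac)
  qed
  finally have A: "of_int (az_term (p * n) (p * j))
     = s * 3 ^ (p * m) * fact (n + j) * fact_unit (n + j) / (fact j ^ 4 * fact m * W)" .
  have B: "of_int (az_term n j) = s * 3 ^ m * fact (n + j) / (fact j ^ 4 * fact m)"
    using az_term_fact[OF assms] unfolding s_def m_def .
  have W: "punit W"
    unfolding W_def by (intro punit_mult punit_power punit_fact_unit)
  have "W * (3 ^ m * of_int (az_term (p * n) (p * j))) = fact_unit (n + j) * (3 ^ (p * m) * of_int (az_term n j))"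
    unfolding A B using punit_nz[OF W] by (simp add: field_simps)
  moreover have "pcong 3 (fact_unit (n + j)) W"
  proof -
    have "pcong 3 W ((fact (p - 1) ^ j) ^ 4 * fact (p - 1) ^ m)"
      unfolding W_def by (intro pcong_mult pcong_power fact_unit_cong pdvd_intros) auto
    also have "(fact (p - 1) ^ j) ^ 4 * fact (p - 1) ^ m = (fact (p - 1) ^ (n + j) :: rat)"
      by (simp add: n power_add[symmetric] power_mult[symmetric] algebra_simps)
    finally show ?thesis
      using fact_unit_cong[of "n + j"] pcong_sym pcong_trans by blast
  qed
  then have "pcong 3 (fact_unit (n + j) * (3 ^ (p * m) * of_int (az_term n j)))
      (W * (3 ^ (p * m) * of_int (az_term n j)))"
    by (rule pcong_mult[OF _ pcong_refl])
      (use punit_integral[OF W] in \<open>auto intro!: pdvd_mult_left pdvd_power\<close>)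
  ultimately show ?thesis
    unfolding m_def[symmetric] using pcong_cancel[OF W] by metis
qed


section \<open>Sums over residue blocks\<close>

definition harm_p :: "nat \<Rightarrow> rat" where
  "harm_p r = of_nat (poch_lin r) / fact r"

text \<open>Taylor expansion at 1: terms of degree two or more in \<open>of_nat p * x\<close> carry
  p^2 and have p-integral coefficients.\<close>

lemma pochhammer_linear:
  assumes x: "pdvd 0 x"
  shows "pcong 2 (pochhammer (1 + of_nat p * x) s) (fact s + of_nat p * x * of_nat (poch_lin s))"
proof (induction s)
  case 0
  then show ?case by simp
next
  case (Suc s)
  let ?P = "of_nat p :: rat" and ?e = "of_nat (poch_lin s) :: rat"
  have "pcong 2 (pochhammer (1 + ?P * x) s * (1 + ?P * x + of_nat s))
      ((fact s + ?P * x * ?e) * (1 + ?P * x + of_nat s))"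
    by (rule pcong_mult[OF Suc.IH]) (use x in \<open>auto intro!: pdvd_add pdvd_mult_left\<close>)
  moreover have "pcong 2 ((fact s + ?P * x * ?e) * (1 + ?P * x + of_nat s))
      (fact (Suc s) + ?P * x * of_nat (poch_lin (Suc s)))"
  proof -
    have "pdvd 2 (?P ^ 2 * (x ^ 2 * ?e))"
      using x by (intro pdvd_mult_right pdvd_p_power pdvd_mult_left pdvd_power) auto
    then show ?thesis
      by (simp add: algebra_simps power2_eq_square)
  qed
  ultimately show ?case
    unfolding pochhammer_Suc by (rule pcong_trans)
qed

lemma pdvd_0_harm_p: "r < p \<Longrightarrow> pdvd 0 (harm_p r)"
  unfolding harm_p_def by (intro pdvd_divide punit_fact) auto

lemma pochhammer_cong_harm_p:
  assumes "pdvd 0 x" "r < p"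
  shows "pcong 2 (pochhammer (1 + of_nat p * x) r) (fact r * (1 + of_nat p * x * harm_p r))"
  using pochhammer_linear[OF assms(1), of r] by (simp add: harm_p_def algebra_simps)

lemma punit_pochhammer:
  assumes "pdvd 0 x" "r < p"
  shows "punit (pochhammer (1 + of_nat p * x) r)"
proof (rule punit_pcong[of 0, OF _ punit_fact[OF assms(2)]])
  have "pcong 1 (pochhammer (1 + of_nat p * x) r) (fact r + of_nat p * x * of_nat (poch_lin r))"
    using pochhammer_linear[OF assms(1)] by (rule pdvd_mono) simp
  moreover have "pdvd (Suc 0) (of_nat p * x * of_nat (poch_lin r))"
    using assms by (intro pdvd_mult_right[OF pdvd_mult_right[OF pdvd_p]]) auto
  ultimately show "pcong (Suc 0) (pochhammer (1 + of_nat p * x) r) (fact r)"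
    using pdvd_add by fastforce
qed

section \<open>The block polynomial B(m)\<close>

definition block_lin :: rat where
  "block_lin = (\<Sum>r\<in>{1..<p}. of_nat p * fact (3 * r - 1) / (27 ^ r * fact r ^ 3))"

definition block_quad :: rat where
  "block_quad = (\<Sum>r\<in>{1..<p}. of_nat p ^ 2 * (fact (3 * r - 1) * harm_p r - of_nat (poch_lin (3 * r - 1)))
     / (27 ^ r * fact r ^ 3))"

text \<open>Here \<open>block_lin\<close> and \<open>block_quad\<close> are U and V of the overview:
  the coefficients of -m and -m^2 that remain when (-pm)_{3r} (1 + p m H_r) / (27^r r!^3) is
  expanded, multiples of p^3 are dropped, and the result is summed over 0 < r < p.\<close>

definition block :: "rat \<Rightarrow> rat" where
  "block m = 1 - m * block_lin - m ^ 2 * block_quad"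

text \<open>
  Only \<open>g\<close> modulo \<open>p^2\<close> matters because the Pochhammer symbol contains the factor \<open>- p m\<close>.  No case
  distinction on whether \<open>3 r - 1 \<ge> p\<close> is needed: \<open>poch_lin\<close> is an integer, whereas \<open>H_(3r-1)\<close> need not
  be p-integral.
\<close>
lemma block_term_cong:
  assumes r: "r \<in> {1..<p}" and m: "pdvd 0 m"
    and g: "pcong 2 (g * fact r ^ 3) (1 + of_nat p * m * harm_p r)"
  shows "pcong 3 (pochhammer (- (of_nat p * m)) (3 * r) * g / 27 ^ r)
           (- m * (of_nat p * fact (3 * r - 1) / (27 ^ r * fact r ^ 3))
            - m ^ 2 * (of_nat p ^ 2 * (fact (3 * r - 1) * harm_p r - of_nat (poch_lin (3 * r - 1)))
                / (27 ^ r * fact r ^ 3)))"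
proof -
  let ?P = "of_nat p :: rat" and ?s = "3 * r - 1" and ?h = "harm_p r"
  define e where "e = (of_nat (poch_lin ?s) :: rat)"
  define w where "w = (fact ?s :: rat)"
  define D where "D = (27 ^ r * fact r ^ 3 :: rat)"
  have D: "punit D"
    using r punit_power[OF punit_3, of 3] by (auto simp: D_def intro!: punit_mult punit_power punit_fact)
  have h: "pdvd 0 ?h" using r by (intro pdvd_0_harm_p) auto
  have ew: "pdvd 0 e" "pdvd 0 w" by (simp_all add: e_def w_def)
  define q where "q = pochhammer (1 + ?P * (- m)) ?s"
  have s: "3 * r = Suc ?s" using r by auto
  have "pochhammer (- (?P * m)) (Suc ?s) = - (?P * m) * q"
    unfolding q_def by (subst pochhammer_rec) (simp add: algebra_simps)
  then have poch: "pochhammer (- (?P * m)) (3 * r) = - (?P * m) * q"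
    by (simp only: s[symmetric])
  have "pcong 2 q (w + ?P * (- m) * e)"
    unfolding q_def w_def e_def using m by (intro pochhammer_linear pdvd_minus)
  then have "pcong 2 (q * (g * fact r ^ 3)) ((w + ?P * (- m) * e) * (1 + ?P * m * ?h))"
    using g by (rule pcong_mult) (use m h ew in \<open>auto intro!: pdvd_add pdvd_diff pdvd_minus pdvd_mult_left\<close>)
  moreover have "pcong 2 ((w + ?P * (- m) * e) * (1 + ?P * m * ?h)) (w + ?P * m * (w * ?h - e))"
  proof -
    have "pdvd 2 (?P ^ 2 * (- (m ^ 2 * e * ?h)))"
      using m ew h by (intro pdvd_mult_right[OF pdvd_p_power] pdvd_mult_left pdvd_power pdvd_minus)
    then show ?thesis
      by (simp add: algebra_simps power2_eq_square)
  qed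
  ultimately have "pcong 2 (q * (g * fact r ^ 3)) (w + ?P * m * (w * ?h - e))"
    by (rule pcong_trans)
  then have "pdvd (1 + 2) (?P * (- m * (q * (g * fact r ^ 3) - (w + ?P * m * (w * ?h - e)))))"
    using m by (intro pdvd_mult pdvd_mult_left pdvd_minus) auto
  then have "pdvd 3 (?P * (- m * (q * (g * fact r ^ 3) - (w + ?P * m * (w * ?h - e)))))"
    by (rule pdvd_mono) simp
  then have "pdvd 3 (?P * (- m * (q * (g * fact r ^ 3) - (w + ?P * m * (w * ?h - e)))) / D)"
    using D by (rule pdvd_divide)
  also have "?P * (- m * (q * (g * fact r ^ 3) - (w + ?P * m * (w * ?h - e)))) / D
      = - (?P * m) * q * g / 27 ^ r - (- m * (?P * w / D) - m ^ 2 * (?P ^ 2 * (w * ?h - e) / D))"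
  proof -
    have "- (?P * m) * q * g / 27 ^ r = - (?P * m) * q * (g * fact r ^ 3) / D"
      by (simp add: D_def)
    then show ?thesis
      using punit_nz[OF D] by (simp add: field_simps power2_eq_square)
  qed
  finally show ?thesis
    unfolding poch w_def e_def D_def .
qed

text \<open>The weight \<open>g\<close> is left open because the lemma serves twice: for the
  Saalschuetz series and for the quotients of Almkvist-Zudilin terms. Both weights have the same
  expansion modulo p^2, so both sums lead to the same polynomial.\<close>

lemma block_cong:
  assumes m: "pdvd 0 m" and "g 0 = 1"
    and "\<And>r. r \<in> {1..<p} \<Longrightarrow> pcong 2 (g r * fact r ^ 3) (1 + of_nat p * m * harm_p r)"
  shows "pcong 3 (\<Sum>r<p. pochhammer (- (of_nat p * m)) (3 * r) * g r / 27 ^ r) (block m)"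
proof -
  have "{..<p} = insert 0 {1..<p}"
    using p_pos by auto
  then have sum: "(\<Sum>r<p. pochhammer (- (of_nat p * m)) (3 * r) * g r / 27 ^ r)
      = 1 + (\<Sum>r\<in>{1..<p}. pochhammer (- (of_nat p * m)) (3 * r) * g r / 27 ^ r)"
    using assms(2) by simp
  have block: "block m = 1 + (\<Sum>r\<in>{1..<p}. - m * (of_nat p * fact (3 * r - 1) / (27 ^ r * fact r ^ 3))
            - m ^ 2 * (of_nat p ^ 2 * (fact (3 * r - 1) * harm_p r - of_nat (poch_lin (3 * r - 1)))
                / (27 ^ r * fact r ^ 3)))"
    unfolding block_def block_lin_def block_quad_def sum_distrib_left sum_subtractf
    by (simp add: sum_negf)
  show ?thesis
    unfolding sum block using m assms(3) by (intro pcong_add pcong_refl pcong_sum block_term_cong)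
qed

text \<open>For these \<open>m\<close> the Saalschuetz series with N = pm satisfies N < 3p, so the
  sum over \<open>r < p\<close> is already the complete series and has a closed form.\<close>

lemma block_cong_small:
  assumes "m \<in> {1, 2}"
  shows "pcong 3 (3 ^ (p * m) * block (of_nat m)) (3 ^ m)"
proof -
  define x where "x = (of_nat m :: rat)"
  define g where "g = (\<lambda>r. 1 / (pochhammer (1 - of_nat p * x) r * fact r ^ 2))"
  have x: "pdvd 0 x" by (simp add: x_def)
  have "pcong 3 (\<Sum>r<p. pochhammer (- (of_nat p * x)) (3 * r) * g r / 27 ^ r) (block x)"
  proof (rule block_cong[OF x])
    show "g 0 = 1" by (simp add: g_def)
    fix r assume r: "r \<in> {1..<p}"
    define q where "q = pochhammer (1 + of_nat p * (- x)) r"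
    define u where "u = of_nat p * x * harm_p r"
    have h: "pdvd 0 (harm_p r)" using r by (intro pdvd_0_harm_p) auto
    have u: "pdvd 0 u" using x h by (auto simp: u_def intro!: pdvd_mult_left)
    have q: "punit q" unfolding q_def using x r by (intro punit_pochhammer pdvd_minus) auto
    have "pcong 2 q (fact r * (1 + of_nat p * (- x) * harm_p r))"
      unfolding q_def using x r by (intro pochhammer_cong_harm_p pdvd_minus) auto
    then have "pcong 2 q (fact r * (1 - u))"
      by (simp add: u_def)
    then have "pcong 2 (q * (1 + u)) (fact r * (1 - u) * (1 + u))"
      by (rule pcong_mult) (use u in \<open>auto intro!: pdvd_add pdvd_diff pdvd_mult_left\<close>)
    \<comment> \<open>As u^2 carries p^2, \<open>1 + u\<close> inverts \<open>1 - u\<close> modulo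
      p^2; this accounts for the Pochhammer symbol standing in the denominator of
      \<open>g\<close>.\<close>
    moreover have "pcong 2 (fact r * (1 - u) * (1 + u)) (fact r)"
    proof -
      have "pdvd 2 (of_nat p ^ 2 * (- fact r * x ^ 2 * harm_p r ^ 2))"
        using x h by (intro pdvd_mult_right[OF pdvd_p_power] pdvd_mult_left pdvd_power pdvd_minus) auto
      then show ?thesis
        by (simp add: u_def algebra_simps power2_eq_square)
    qed
    ultimately have "pcong 2 (q * (1 + u)) (fact r)"
      by (rule pcong_trans)
    moreover have "g r * fact r ^ 3 = fact r / q"
      by (simp add: g_def q_def power2_eq_square power3_eq_cube)
    ultimately show "pcong 2 (g r * fact r ^ 3) (1 + of_nat p * x * harm_p r)"
      unfolding u_def[symmetric]
      using pcong_cancel[OF q, of 2 "fact r / q" "1 + u"] punit_nz[OF q] pcong_sym by simp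
  qed
  also have "(\<Sum>r<p. pochhammer (- (of_nat p * x)) (3 * r) * g r / 27 ^ r) = (\<Sum>r<p. saal (p * m) r)"
    by (intro sum.cong) (simp_all add: saal_def g_def x_def mult_ac)
  finally have S: "pcong 3 (\<Sum>r<p. saal (p * m) r) (block x)" .
  have "pcong 3 (2 * 3 ^ (p * m) * (\<Sum>r<p. saal (p * m) r)) (2 * 3 ^ (p * m) * block x)"
    using pdvd_mult_left[of "2 * 3 ^ (p * m)" 3, OF _ S]
    by (simp add: right_diff_distrib pdvd_mult_left pdvd_power)
  then have "pcong 3 (2 * 3 ^ (p * m) * block x) (2 * 3 ^ (p * m) * (\<Sum>r<p. saal (p * m) r))"
    by (rule pcong_sym)
  also have "2 * 3 ^ (p * m) * (\<Sum>r<p. saal (p * m) r) = 3 * of_nat ((2 * (p * m)) choose (p * m))"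
    using assms p_pos by (intro sum_saal) auto
  also have "pcong 3 \<dots> (3 * of_nat ((2 * m) choose m))"
    by (intro pcong_mult central_binomial_cong) auto
  \<comment> \<open>An exact equality for \<open>m = 1\<close> (both 6) and \<open>m = 2\<close>
    (both 18); at \<open>m = 3\<close> it would fail, with 60 against 54.\<close>
  also have "3 * of_nat ((2 * m) choose m) = (2 * 3 ^ m :: rat)"
  proof -
    have "(4 choose 2) = (6 :: nat)" by (simp add: eval_nat_numeral)
    then show ?thesis using assms by auto
  qed
  finally show ?thesis
    unfolding x_def using pcong_cancel[OF punit_2] by (simp add: mult.assoc)
qed

section \<open>From m = 1, 2 to all m\<close>

lemma one_plus_power_cong:
  assumes "pdvd 1 t"
  shows "pcong 3 ((1 + t) ^ m) (1 + of_nat m * t + of_nat m * (of_nat m - 1) / 2 * t ^ 2)"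
proof (induction m)
  case 0
  then show ?case by simp
next
  case (Suc m)
  have t: "pdvd 0 t" using assms pdvd_0 by blast
  let ?m = "of_nat m :: rat"
  define c where "c = ?m * (?m - 1) / 2"
  have c': "of_nat (Suc m) * (of_nat (Suc m) - 1) / 2 = c + ?m"
    by (simp add: c_def field_simps)
  have c: "pdvd 0 c"
    unfolding c_def by (intro pdvd_divide pdvd_mult_left pdvd_diff punit_2) auto
  have "pcong 3 ((1 + t) * (1 + t) ^ m) ((1 + t) * (1 + ?m * t + c * t ^ 2))"
    by (rule pcong_mult[OF pcong_refl Suc.IH[folded c_def]])
      (use t c in \<open>auto intro!: pdvd_add pdvd_mult_left pdvd_power\<close>)
  moreover have "pcong 3 ((1 + t) * (1 + ?m * t + c * t ^ 2)) (1 + of_nat (Suc m) * t + (c + ?m) * t ^ 2)"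
  proof -
    have "pdvd (1 + (1 + 1)) (t * (t * t))"
      using assms by (intro pdvd_mult)
    then have "pdvd 3 (t * (t * t))"
      by (simp add: numeral_3_eq_3)
    then have "pdvd 3 (c * (t * (t * t)))"
      using c by (rule pdvd_mult_left[rotated])
    then show ?thesis
      by (simp add: algebra_simps power2_eq_square)
  qed
  ultimately show ?case
    unfolding power_Suc c' by (rule pcong_trans)
qed

text \<open>With y = 3^(1-p) the claim reads B(m) = y^m modulo p^3. By Fermat y = 1 + t with
  \<open>p\<close> dividing t, so y^m is itself quadratic in m modulo p^3; two quadratics that agree
  at 0, 1 and 2 agree at every m, since 2 is a unit.\<close>

lemma block_cong_power: "pcong 3 (3 ^ (p * m) * block (of_nat m)) (3 ^ m)"
proof -
  define y where "y = (1 / 3 ^ (p - 1) :: rat)"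
  define t where "t = y - 1"
  have u: "punit (3 ^ k)" for k by (intro punit_power punit_3)
  have p3: "3 ^ (p * m) = (3 ^ (p - 1)) ^ m * (3 ^ m :: rat)" for m
  proof -
    have "p * m = (p - 1) * m + m"
      using p_pos by (simp add: algebra_simps diff_mult_distrib)
    then show ?thesis by (simp only: power_add power_mult)
  qed
  have y: "(3 ^ (p - 1)) ^ m * y ^ m = 1" for m
    by (simp add: y_def power_mult_distrib[symmetric])
  have small: "pcong 3 (block (of_nat m)) (y ^ m)" if "m \<in> {1, 2}" for m
  proof (rule pcong_cancel[OF u[of "p * m"]])
    have "3 ^ (p * m) * y ^ m = 3 ^ m"
      unfolding p3 using y[of m] by simp
    then show "pcong 3 (3 ^ (p * m) * block (of_nat m)) (3 ^ (p * m) * y ^ m)"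
      using block_cong_small[OF that] by simp
  qed
  have "pdvd 1 t"
  proof (rule punit_cancel[OF u[of "p - 1"]])
    have "\<not> p dvd 3"
      using p_ge_5 by (auto dest: dvd_imp_le)
    then have "[3 ^ (p - 1) = 1] (mod p)"
      by (rule fermat_theorem[OF prime_p])
    then have "[int (3 ^ (p - 1)) = int 1] (mod int p)"
      by (simp only: cong_int_iff)
    then have "int p ^ 1 dvd 1 - 3 ^ (p - 1)"
      by (simp add: cong_iff_dvd_diff dvd_diff_commute)
    then have "pdvd 1 (of_int (1 - 3 ^ (p - 1)))"
      by (simp only: pdvd_of_int_iff)
    then show "pdvd 1 (3 ^ (p - 1) * t)"
      by (simp add: t_def y_def right_diff_distrib)
  qed
  have t0: "pdvd 0 t" using \<open>pdvd 1 t\<close> pdvd_0 by blast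
  let ?m = "of_nat m :: rat"
  have half: "pdvd 0 (?m * (?m - 1) / 2)"
    by (auto intro!: pdvd_mult_left pdvd_divide pdvd_diff punit_2)
  \<comment> \<open>Newton's forward difference formula at 0, 1, 2, where B(0) = 1.\<close>
  have "block ?m = 1 + ?m * (block 1 - 1) + ?m * (?m - 1) / 2 * (block 2 - 2 * block 1 + 1)"
    by (simp add: block_def field_simps power2_eq_square)
  also have "pcong 3 \<dots> (1 + ?m * t + ?m * (?m - 1) / 2 * t ^ 2)"
  proof -
    have b1: "pdvd 3 (block 1 - y)" and b2: "pdvd 3 (block 2 - y ^ 2)"
      using small[of 1] small[of 2] by simp_all
    have "pdvd 3 (?m * (block 1 - y) + ?m * (?m - 1) / 2 * ((block 2 - y ^ 2) - 2 * (block 1 - y)))"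
      by (rule pdvd_add[OF pdvd_mult_left[OF _ b1]
            pdvd_mult_left[OF half pdvd_diff[OF b2 pdvd_mult_left[OF _ b1]]]]) simp_all
    moreover have "1 + ?m * (block 1 - 1) + ?m * (?m - 1) / 2 * (block 2 - 2 * block 1 + 1)
        - (1 + ?m * t + ?m * (?m - 1) / 2 * t ^ 2)
      = ?m * (block 1 - y) + ?m * (?m - 1) / 2 * ((block 2 - y ^ 2) - 2 * (block 1 - y))"
      by (simp add: t_def field_simps power2_eq_square)
    ultimately show ?thesis by simp
  qed
  also have "pcong 3 (1 + ?m * t + ?m * (?m - 1) / 2 * t ^ 2) ((1 + t) ^ m)"
    by (rule pcong_sym[OF one_plus_power_cong[OF \<open>pdvd 1 t\<close>]])
  finally have "pcong 3 (block ?m) (y ^ m)"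
    by (simp add: t_def)
  then have "pcong 3 (3 ^ (p * m) * block ?m) (3 ^ (p * m) * y ^ m)"
    using pdvd_mult_left[of "3 ^ (p * m)" 3 "block ?m - y ^ m"] pdvd_power[of 3 "p * m"]
    by (simp add: right_diff_distrib)
  also have "3 ^ (p * m) * y ^ m = 3 ^ m"
    unfolding p3 using y[of m] by simp
  finally show ?thesis .
qed

text \<open>By \<open>az_term_add\<close> the block is its first term times a sum to which
  \<open>block_cong\<close> applies. The first term contributes the factor 3^((p-1)m), which the
  block polynomial undoes by \<open>block_cong_power\<close>.\<close>

lemma az_block_cong:
  assumes "3 * j \<le> n"
  shows "pcong 3 (of_int (\<Sum>r<p. az_term (p * n) (p * j + r))) (of_int (az_term n j))"
proof -
  define m where "m = n - 3 * j"
  define x where "x = (of_nat m :: rat)"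
  have n: "n = 3 * j + m" using assms by (simp add: m_def)
  define a where "a = (of_nat (n + j) :: rat)"
  define b where "b = (of_nat j :: rat)"
  define g where "g = (\<lambda>r. pochhammer (1 + of_nat p * a) r / pochhammer (1 + of_nat p * b) r ^ 4)"
  define S where "S = (\<Sum>r<p. pochhammer (- (of_nat p * x)) (3 * r) * g r / 27 ^ r)"
  have "of_int (az_term (p * n) (p * j + r))
      = of_int (az_term (p * n) (p * j)) * (pochhammer (- (of_nat p * x)) (3 * r) * g r / 27 ^ r)" for r
  proof -
    have e: "- of_nat (p * n) + 3 * of_nat (p * j) = - (of_nat p * x)"
      "of_nat (p * n + p * j) + 1 = 1 + of_nat p * a" "of_nat (p * j) + 1 = 1 + of_nat p * b"
      by (simp_all add: n x_def a_def b_def algebra_simps)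
    then show ?thesis
      unfolding az_term_add e g_def by (simp add: mult_ac)
  qed
  then have sum: "of_int (\<Sum>r<p. az_term (p * n) (p * j + r)) = of_int (az_term (p * n) (p * j)) * S"
    by (simp add: S_def sum_distrib_left)
  have S: "pcong 3 S (block x)"
    unfolding S_def
  proof (rule block_cong)
    show "pdvd 0 x" by (simp add: x_def)
    show "g 0 = 1" by (simp add: g_def)
    fix r assume r: "r \<in> {1..<p}"
    define A where "A = pochhammer (1 + of_nat p * a) r"
    define B where "B = pochhammer (1 + of_nat p * b) r"
    define h where "h = harm_p r"
    define P where "P = (of_nat p :: rat)"
    define w where "w = (fact r :: rat)"
    have h: "pdvd 0 h" using r by (auto simp: h_def intro!: pdvd_0_harm_p)
    have int: "pdvd 0 a" "pdvd 0 b" "pdvd 0 x" "pdvd 0 P" "pdvd 0 w"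
      by (auto simp: a_def b_def x_def P_def w_def intro!: pdvd_add)
    have A: "pcong 2 A (w * (1 + P * a * h))" and B: "pcong 2 B (w * (1 + P * b * h))"
      unfolding A_def B_def w_def P_def h_def using r int by (auto intro!: pochhammer_cong_harm_p)
    have uB: "punit B" unfolding B_def using r int by (intro punit_pochhammer) auto
    have B4: "pcong 2 (B ^ 4) ((w * (1 + P * b * h)) ^ 4)"
      using B int h by (intro pcong_power) (auto intro!: pdvd_mult_left pdvd_add)
    have "pcong 2 (B ^ 4 * (1 + P * x * h)) ((w * (1 + P * b * h)) ^ 4 * (1 + P * x * h))"
      by (rule pcong_mult[OF B4 pcong_refl]) (use int h in \<open>auto intro!: pdvd_mult_left pdvd_add pdvd_power\<close>)
    moreover have "pcong 2 ((w * (1 + P * b * h)) ^ 4 * (1 + P * x * h)) (w ^ 3 * (w * (1 + P * a * h)))"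
    proof -
      \<comment> \<open>This balance is why only m survives: to first order, (1 + P a h) / (1 + P b
        h)^4 is 1 + P (a - 4b) h = 1 + P x h.\<close>
      have ax: "a = 4 * b + x" by (simp add: a_def b_def x_def n)
      define v where "v = P * (b * h)"
      define z where "z = P * (x * h)"
      have "(w * (1 + v)) ^ 4 * (1 + z) - w ^ 3 * (w * (1 + (4 * v + z)))
          = w ^ 4 * (v * z * (4 + 6 * v + 4 * v^2 + v^3) + v^2 * (6 + 4 * v + v^2))"
        by (simp add: power_mult_distrib algebra_simps power2_eq_square power3_eq_cube power4_eq_xxxx)
      moreover have "pdvd 2 (w ^ 4 * (v * z * (4 + 6 * v + 4 * v^2 + v^3) + v^2 * (6 + 4 * v + v^2)))"
      proof -
        have "pdvd (1 + 1) (v * z)" "pdvd (1 + 1) (v * v)"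
          unfolding v_def z_def P_def using int h
          by (intro pdvd_mult pdvd_mult_right pdvd_mult_left; simp)+
        then have vz: "pdvd 2 (v * z)" and vv: "pdvd 2 (v ^ 2)"
          by (simp_all only: one_add_one power2_eq_square)
        have v: "pdvd 0 v"
          using int h by (simp add: v_def pdvd_mult_left)
        show ?thesis
          by (rule pdvd_mult_left[OF _ pdvd_add[OF pdvd_mult_right[OF vz] pdvd_mult_right[OF vv]]])
            (use v int in \<open>auto intro!: pdvd_mult_left pdvd_add pdvd_power\<close>)
      qed
      ultimately show ?thesis
        by (simp add: ax v_def z_def algebra_simps)
    qed
    moreover have "pcong 2 (w ^ 3 * (w * (1 + P * a * h))) (w ^ 3 * A)"
      by (rule pcong_sym, rule pcong_mult[OF pcong_refl A])
        (use int h in \<open>auto intro!: pdvd_mult_left pdvd_add pdvd_power\<close>)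
    ultimately have "pcong 2 (B ^ 4 * (1 + P * x * h)) (w ^ 3 * A)"
      using pcong_trans by blast
    moreover have "w ^ 3 * A = B ^ 4 * (g r * w ^ 3)"
      using punit_nz[OF uB] unfolding g_def A_def[symmetric] B_def[symmetric] by simp
    ultimately have "pcong 2 (g r * w ^ 3) (1 + P * x * h)"
      using pcong_cancel[OF punit_power[OF uB], of 2 4] pcong_sym by metis
    then show "pcong 2 (g r * fact r ^ 3) (1 + of_nat p * x * harm_p r)"
      by (simp only: w_def P_def h_def)
  qed
  have bl: "pcong 3 (3 ^ (p * m) * block x) (3 ^ m)"
    unfolding x_def by (rule block_cong_power)
  have u: "punit (3 ^ k)" for k by (intro punit_power punit_3)
  \<comment> \<open>Integrality of \<open>block x\<close>, required for multiplying congruences, is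
    read off from its congruence to a power of 3.\<close>
  have "pdvd 0 (3 ^ (p * m) * block x)"
    using pcong_integral[OF bl] by (simp add: pdvd_power)
  then have "pdvd 0 (block x)"
    using punit_cancel[OF u] by blast
  then have "pcong 3 ((3 ^ m * of_int (az_term (p * n) (p * j))) * S)
      ((3 ^ (p * m) * of_int (az_term n j)) * block x)"
    unfolding m_def using S[unfolded x_def m_def]
    by (intro pcong_mult az_term_cong assms) (auto simp: x_def m_def intro!: pdvd_mult_left pdvd_power)
  also have "(3 ^ (p * m) * of_int (az_term n j)) * block x = (3 ^ (p * m) * block x) * of_int (az_term n j)"
    by simp
  also have "pcong 3 \<dots> (3 ^ m * of_int (az_term n j))"
    using bl by (intro pcong_mult) (auto intro: pdvd_power)
  finally have "pcong 3 (3 ^ m * (of_int (az_term (p * n) (p * j)) * S)) (3 ^ m * of_int (az_term n j))"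
    by (simp add: mult.assoc)
  then show ?thesis
    unfolding sum by (rule pcong_cancel[OF u])
qed

section \<open>Assembly of the blocks\<close>

theorem almkvist_zudilin_supercongruence:
  "[almkvist_zudilin (p * n) = almkvist_zudilin n] (mod (int p ^ 3))"
proof -
  \<comment> \<open>With this choice every \<open>j < K\<close> satisfies
    \<open>3 * j \<le> n\<close>, as \<open>az_block_cong\<close> requires, while the
    \<open>K * p\<close> indices exhaust the sum for pn.\<close>
  define K where "K = n div 3 + 1"
  have K: "n < 3 * K" by (simp add: K_def)
  then have "p * n < 3 * (K * p)"
    using p_pos by (simp add: mult.commute mult.left_commute)
  then have "almkvist_zudilin (p * n) = (\<Sum>k<K * p. az_term (p * n) k)"
    by (rule almkvist_zudilin_eq_sum)
  also have "\<dots> = (\<Sum>j<K. \<Sum>k\<in>{j * p..<j * p + p}. az_term (p * n) k)"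
    by (rule sum.nat_group[symmetric])
  also have "\<dots> = (\<Sum>j<K. \<Sum>r<p. az_term (p * n) (p * j + r))"
  proof (rule sum.cong[OF refl])
    fix j
    show "(\<Sum>k\<in>{j * p..<j * p + p}. az_term (p * n) k) = (\<Sum>r<p. az_term (p * n) (p * j + r))"
      by (rule sum.reindex_bij_witness[of _ "\<lambda>r. p * j + r" "\<lambda>k. k - p * j"])
        (auto simp: mult.commute)
  qed
  finally have pn: "almkvist_zudilin (p * n) = (\<Sum>j<K. \<Sum>r<p. az_term (p * n) (p * j + r))" .
  have "pcong 3 (\<Sum>j<K. of_int (\<Sum>r<p. az_term (p * n) (p * j + r))) (\<Sum>j<K. of_int (az_term n j))"
    by (intro pcong_sum az_block_cong) (auto simp: K_def)
  then have "pdvd 3 (of_int (almkvist_zudilin (p * n) - almkvist_zudilin n))"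
    by (simp add: pn almkvist_zudilin_eq_sum[OF K])
  then show ?thesis
    by (simp only: pdvd_of_int_iff cong_iff_dvd_diff)
qed

end

theorem mainTheorem1:
  fixes p n :: nat
  assumes "prime p" and "p \<ge> 5" and "n \<ge> 1"
  shows "[almkvist_zudilin (p * n) = almkvist_zudilin n] (mod (int p ^ 3))"
proof -
  interpret prime_ge_5 p
    using assms by unfold_locales
  show ?thesis
    by (rule almkvist_zudilin_supercongruence)
qed

end
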